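(* Let $h$ be a Hessenberg function with degree tuple $\beta$. The generating set $\mathcal{J}_h=\{\tilde e_{\beta_n}(n),\tilde e_{\beta_{n-1}}(n-1,n),\ldots,\tilde e_{\beta_1}(1,\ldots,n)\}$ is a Gröbner basis for the ideal $J_h$ of $\mathbb{Z}[x_1,\ldots,x_n]$ with respect to the lexicographic or the graded lexicographic monomial order.
   Context: A Hessenberg function is an $n$-tuple $h=(h_1,\ldots,h_n)$ of integers with $i\le h_i\le n$ and $h_i\le h_{i+1}$. Its degree tuple is $\beta=(\beta_n,\ldots,\beta_1)$ with $\beta_i=i-\#\{k:h_k<i\}$. For $S\subseteq\{1,\ldots,n\}$, $\tilde e_d(S)$ is the sum of all monomials (not necessarily squarefree) of degree $d$ in the variables $x_i$, $i\in S$, and $\tilde e_d(i,\ldots,n)$ means $S=\{i,\ldots,n\}$. $J_h$ is the ideal generated by $\mathcal{J}_h$. Lexicographic order: $x^\alpha>x^\gamma$ if the leftmost nonzero entry of $\alpha-\gamma$ is positive (so $x_1>x_2>\cdots>x_n$); graded lex compares total degree first and then lex. A set $G=\{g_1,\ldots,g_t\}$ is a Gröbner basis of an ideal $I$ if the ideal generated by leading terms of all elements of $I$ equals $\langle LT(g_1),\ldots,LT(g_t)\rangle$. *)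

theory Defs
  imports "HOL-Algebra.Ideal" "HOL-Library.Poly_Mapping"
begin

text \<open>
  A monomial \<open>x\<^sup>\<alpha>\<close> is represented by its exponent vector, a finitely supported function from
  variable indices to exponents; a polynomial is a finitely supported function from monomials
  to integer coefficients.  Variables are indexed from 1.
\<close>

type_synonym monomial = "nat \<Rightarrow>\<^sub>0 nat"
type_synonym mpoly_int = "monomial \<Rightarrow>\<^sub>0 int"

definition int_mpoly_ring :: "nat \<Rightarrow> mpoly_int ring" where
  "int_mpoly_ring n =
     \<lparr>carrier = {f. \<forall>m \<in> Poly_Mapping.keys f. Poly_Mapping.keys m \<subseteq> {1..n}},
      mult = (*), one = 1, zero = 0, add = (+)\<rparr>"

definition total_degree :: "monomial \<Rightarrow> nat" where
  "total_degree m = (\<Sum>i \<in> Poly_Mapping.keys m. Poly_Mapping.lookup m i)"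

text \<open>
  Monomial orders are given by their strict part.  Reading positions from left to right is reading
  indices in increasing order, so that \<open>x\<^sub>1 > x\<^sub>2 > \<dots> > x\<^sub>n\<close>; index 0 plays no role for monomials
  in \<open>x\<^sub>1, \<dots>, x\<^sub>n\<close>.
\<close>

definition lex_less :: "monomial \<Rightarrow> monomial \<Rightarrow> bool" where
  "lex_less \<gamma> \<alpha> \<longleftrightarrow>
     (\<exists>i. Poly_Mapping.lookup \<gamma> i < Poly_Mapping.lookup \<alpha> i \<and>
          (\<forall>j < i. Poly_Mapping.lookup \<alpha> j = Poly_Mapping.lookup \<gamma> j))"

definition grlex_less :: "monomial \<Rightarrow> monomial \<Rightarrow> bool" where
  "grlex_less \<gamma> \<alpha> \<longleftrightarrow>
     total_degree \<gamma> < total_degree \<alpha> \<or>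
     total_degree \<gamma> = total_degree \<alpha> \<and> lex_less \<gamma> \<alpha>"

definition leading_monomial :: "(monomial \<Rightarrow> monomial \<Rightarrow> bool) \<Rightarrow> mpoly_int \<Rightarrow> monomial" where
  "leading_monomial lt f =
     (THE m. m \<in> Poly_Mapping.keys f \<and> (\<forall>m' \<in> Poly_Mapping.keys f. m' \<noteq> m \<longrightarrow> lt m' m))"

text \<open>Over the integers the leading term has to include its coefficient.\<close>

definition leading_term :: "(monomial \<Rightarrow> monomial \<Rightarrow> bool) \<Rightarrow> mpoly_int \<Rightarrow> mpoly_int" where
  "leading_term lt f =
     (if f = 0 then 0
      else Poly_Mapping.single (leading_monomial lt f)
             (Poly_Mapping.lookup f (leading_monomial lt f)))"

definition groebner_basis ::
  "nat \<Rightarrow> (monomial \<Rightarrow> monomial \<Rightarrow> bool) \<Rightarrow> mpoly_int set \<Rightarrow> mpoly_int set \<Rightarrow> bool" where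
  "groebner_basis n lt G I \<longleftrightarrow>
     ideal I (int_mpoly_ring n) \<and> finite G \<and> G \<subseteq> I \<and>
     genideal (int_mpoly_ring n) (leading_term lt ` I) =
     genideal (int_mpoly_ring n) (leading_term lt ` G)"

text \<open>Only the values \<open>h 1, \<dots>, h n\<close> are relevant.\<close>

definition hessenberg :: "nat \<Rightarrow> (nat \<Rightarrow> nat) \<Rightarrow> bool" where
  "hessenberg n h \<longleftrightarrow>
     (\<forall>i \<in> {1..n}. i \<le> h i \<and> h i \<le> n) \<and> (\<forall>i \<in> {1..<n}. h i \<le> h (i + 1))"

text \<open>
  For a Hessenberg function, \<open>h k < i\<close> implies \<open>k < i\<close>, so the subtraction does not truncate
  (the value is at least 1 for \<open>i \<ge> 1\<close>).
\<close>

definition degree_tuple :: "nat \<Rightarrow> (nat \<Rightarrow> nat) \<Rightarrow> nat \<Rightarrow> nat" where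
  "degree_tuple n h i = i - card {k \<in> {1..n}. h k < i}"

text \<open>The complete homogeneous sum; meant for finite \<open>S\<close>.\<close>

definition e_tilde :: "nat \<Rightarrow> nat set \<Rightarrow> mpoly_int" where
  "e_tilde d S =
    (\<Sum>m \<in> {m. Poly_Mapping.keys m \<subseteq> S \<and> total_degree m = d}.
     Poly_Mapping.single m 1)"

definition J_generators :: "nat \<Rightarrow> (nat \<Rightarrow> nat) \<Rightarrow> mpoly_int set" where
  "J_generators n h = {e_tilde (degree_tuple n h i) {i..n} | i. i \<in> {1..n}}"

definition J_ideal :: "nat \<Rightarrow> (nat \<Rightarrow> nat) \<Rightarrow> mpoly_int set" where
  "J_ideal n h = genideal (int_mpoly_ring n) (J_generators n h)"

end

theory Submission
  imports Defs
begin

text \<open>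
  The leading monomial of \<open>g\<^sub>i = e_tilde \<beta>\<^sub>i {i..n}\<close> is \<open>x\<^sub>i\<close> to the power \<open>\<beta>\<^sub>i\<close>, with coefficient 1,
  and \<open>g\<^sub>i\<close> does not involve \<open>x\<^sub>1, \<dots>, x\<^bsub>i-1\<^esub>\<close>.  By induction on \<open>k\<close>, the leading monomial of every
  nonzero \<open>f\<close> in \<open>\<langle>g\<^sub>1, \<dots>, g\<^sub>k\<rangle>\<close> is divisible by one of these powers with \<open>i \<le> k\<close>: write
  \<open>f = f' + q g\<^sub>k\<close> with \<open>f'\<close> in the previous ideal and \<open>q\<close> reduced modulo \<open>g\<^sub>1, \<dots>, g\<^bsub>k-1\<^esub>\<close>.  Then no
  monomial of \<open>q g\<^sub>k\<close> is divisible by a power with \<open>i < k\<close>, while the leading monomial of \<open>f'\<close> is, so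
  the two leading monomials differ and the larger one is that of \<open>f\<close>.
\<close>

section \<open>Degrees of monomials and the monomials of complete homogeneous sums\<close>

lemma total_degree_superset:
  assumes "finite S" "Poly_Mapping.keys m \<subseteq> S"
  shows "total_degree m = (\<Sum>i\<in>S. Poly_Mapping.lookup m i)"
  unfolding total_degree_def
  by (rule sum.mono_neutral_left) (use assms in \<open>auto simp: in_keys_iff\<close>)

lemma total_degree_add: "total_degree (a + b) = total_degree a + total_degree b"
proof -
  let ?S = "Poly_Mapping.keys a \<union> Poly_Mapping.keys b"
  have "Poly_Mapping.keys (a + b) \<subseteq> ?S" by (rule keys_add)
  then have "total_degree (a + b) = (\<Sum>i\<in>?S. Poly_Mapping.lookup (a + b) i)"
    by (intro total_degree_superset) auto
  moreover have "total_degree a = (\<Sum>i\<in>?S. Poly_Mapping.lookup a i)"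
    and "total_degree b = (\<Sum>i\<in>?S. Poly_Mapping.lookup b i)"
    by (auto intro!: total_degree_superset)
  ultimately show ?thesis by (simp add: lookup_add sum.distrib)
qed

lemma total_degree_single: "total_degree (Poly_Mapping.single i d) = d"
  by (simp add: total_degree_def)

lemma lookup_le_total_degree: "Poly_Mapping.lookup m i \<le> total_degree m"
proof (cases "i \<in> Poly_Mapping.keys m")
  case True
  then show ?thesis unfolding total_degree_def by (intro member_le_sum) auto
qed (simp add: in_keys_iff)

lemma lookup_eq_total_degree_imp_single:
  assumes "Poly_Mapping.lookup m i = total_degree m"
  shows "m = Poly_Mapping.single i (total_degree m)"
proof -
  let ?S = "insert i (Poly_Mapping.keys m)"
  have "total_degree m = (\<Sum>j\<in>?S. Poly_Mapping.lookup m j)"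
    by (rule total_degree_superset) auto
  also have "\<dots> = Poly_Mapping.lookup m i + (\<Sum>j\<in>?S - {i}. Poly_Mapping.lookup m j)"
    by (rule sum.remove) auto
  finally have "(\<Sum>j\<in>?S - {i}. Poly_Mapping.lookup m j) = 0" using assms by simp
  then have "\<forall>j\<in>?S - {i}. Poly_Mapping.lookup m j = 0" by (subst (asm) sum_eq_0_iff) auto
  then have "Poly_Mapping.lookup m j = 0" if "j \<noteq> i" for j
    using that by (metis Diff_iff in_keys_iff insertCI singletonD)
  then show ?thesis
    using assms by (intro poly_mapping_eqI) (auto simp: lookup_single when_def)
qed

definition monomials_of_degree :: "nat \<Rightarrow> nat set \<Rightarrow> monomial set" where
  "monomials_of_degree d S = {m. Poly_Mapping.keys m \<subseteq> S \<and> total_degree m = d}"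

text \<open>Every exponent is at most \<open>d\<close>, so these monomials embed into the functions
  from \<open>S\<close> to \<open>{..d}\<close>. Finiteness matters because a sum over an infinite
  set is 0 by default, which would make \<open>e_tilde\<close> meaningless.\<close>

lemma finite_monomials_of_degree:
  assumes "finite S"
  shows "finite (monomials_of_degree d S)"
proof -
  let ?F = "{f :: nat \<Rightarrow> nat. \<forall>x. (x \<in> S \<longrightarrow> f x \<in> {..d}) \<and> (x \<notin> S \<longrightarrow> f x = 0)}"
  have "finite ?F" by (rule finite_set_of_finite_funs) (use assms in auto)
  moreover have "Poly_Mapping.lookup ` monomials_of_degree d S \<subseteq> ?F"
    using lookup_le_total_degree by (auto simp: monomials_of_degree_def in_keys_iff)
  ultimately have "finite (Poly_Mapping.lookup ` monomials_of_degree d S)"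
    by (rule rev_finite_subset)
  then show ?thesis
    by (rule finite_imageD) (auto intro: inj_onI simp: poly_mapping.lookup_inject)
qed

lemma lookup_e_tilde:
  assumes "finite S"
  shows "Poly_Mapping.lookup (e_tilde d S) m = (if m \<in> monomials_of_degree d S then 1 else 0)"
  using finite_monomials_of_degree[OF assms, of d]
  by (simp add: e_tilde_def monomials_of_degree_def[symmetric] lookup_sum lookup_single when_def
      del: mem_Collect_eq)

lemma keys_e_tilde:
  assumes "finite S"
  shows "Poly_Mapping.keys (e_tilde d S) = monomials_of_degree d S"
  using assms by (auto simp: in_keys_iff lookup_e_tilde split: if_splits)

text \<open>The library order on \<open>poly_mapping\<close> also decides at the first differing
  index. Totality and compatibility with addition are thus inherited from its class
  instances.\<close>

lemma lex_less_eq_less: "lex_less = (<)"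
  by (intro ext) (auto simp: lex_less_def less_poly_mapping.rep_eq less_fun_def)

text \<open>No variable before \<open>i\<close> occurs in \<open>m\<close>, and its exponent at
  \<open>i\<close> reaches \<open>d\<close> only if all of the degree sits there. So
  \<open>i\<close> is the first index where the two monomials differ.\<close>

lemma monomials_of_degree_less_single:
  assumes "m \<in> monomials_of_degree d {i..n}" "m \<noteq> Poly_Mapping.single i d"
  shows "m < Poly_Mapping.single i d"
proof -
  have deg: "total_degree m = d" and k: "Poly_Mapping.keys m \<subseteq> {i..n}"
    using assms by (auto simp: monomials_of_degree_def)
  have "Poly_Mapping.lookup m i < d"
    using assms(2) lookup_eq_total_degree_imp_single[of m i] lookup_le_total_degree[of m i] deg
    by fastforce
  moreover have "Poly_Mapping.lookup m j = 0" if "j < i" for j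
  proof -
    have "j \<notin> Poly_Mapping.keys m" using k that by auto
    then show ?thesis by (simp add: in_keys_iff)
  qed
  ultimately have "lex_less m (Poly_Mapping.single i d)"
    unfolding lex_less_def by (intro exI[of _ i]) (auto simp: lookup_single when_def)
  then show ?thesis by (simp add: lex_less_eq_less)
qed

lemma single_in_monomials_of_degree:
  "i \<in> S \<Longrightarrow> Poly_Mapping.single i d \<in> monomials_of_degree d S"
  by (auto simp: monomials_of_degree_def total_degree_single)

section \<open>Leading monomials with respect to an abstract monomial order\<close>

locale monomial_order =
  fixes lt :: "monomial \<Rightarrow> monomial \<Rightarrow> bool"
  assumes irrefl: "\<not> lt a a"
    and trans: "lt a b \<Longrightarrow> lt b c \<Longrightarrow> lt a c"
    and total: "a \<noteq> b \<Longrightarrow> lt a b \<or> lt b a"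
    and add_right: "lt a b \<Longrightarrow> lt (a + c) (b + c)"
begin

text \<open>As a relation it simply fails for the zero polynomial, where the description operator in
  \<open>leading_monomial\<close> would give an unspecified value.\<close>

definition is_lm :: "mpoly_int \<Rightarrow> monomial \<Rightarrow> bool" where
  "is_lm f m \<longleftrightarrow> m \<in> Poly_Mapping.keys f \<and> (\<forall>m' \<in> Poly_Mapping.keys f. m' \<noteq> m \<longrightarrow> lt m' m)"

lemma is_lm_unique: "is_lm f m \<Longrightarrow> is_lm f m' \<Longrightarrow> m = m'"
  unfolding is_lm_def by (metis irrefl trans)

lemma is_lm_imp_leading_monomial: "is_lm f m \<Longrightarrow> leading_monomial lt f = m"
  unfolding leading_monomial_def
  by (rule the_equality) (metis is_lm_def is_lm_unique)+

lemma finite_has_greatest: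
  assumes "finite A" "A \<noteq> {}"
  shows "\<exists>m\<in>A. \<forall>m'\<in>A. m' \<noteq> m \<longrightarrow> lt m' m"
  using assms
proof (induction A rule: finite_ne_induct)
  case (insert x F)
  then obtain m where m: "m \<in> F" "\<forall>m'\<in>F. m' \<noteq> m \<longrightarrow> lt m' m" by blast
  show ?case
  proof (cases "lt x m")
    case True
    then show ?thesis using m by blast
  next
    case False
    with insert.hyps m have "lt m x" using total[of m x] by blast
    then have "\<forall>m'\<in>insert x F. m' \<noteq> x \<longrightarrow> lt m' x" using m trans by (metis insertE)
    then show ?thesis by blast
  qed
qed simp

lemma ex_is_lm: "f \<noteq> 0 \<Longrightarrow> \<exists>m. is_lm f m"
  using finite_has_greatest[of "Poly_Mapping.keys f"] by (auto simp: is_lm_def)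

lemma is_lm_add:
  assumes "is_lm f m" "\<And>m'. m' \<in> Poly_Mapping.keys g \<Longrightarrow> lt m' m"
  shows "is_lm (f + g) m"
proof -
  have "m \<notin> Poly_Mapping.keys g" using assms(2) irrefl by blast
  then have "m \<in> Poly_Mapping.keys (f + g)"
    using assms(1) by (simp add: is_lm_def in_keys_iff lookup_add)
  then show ?thesis
    using assms keys_add[of f g] unfolding is_lm_def by blast
qed

text \<open>The larger of \<open>a\<close> and \<open>b\<close> exceeds every monomial of the other
  summand, so it cannot cancel.\<close>

lemma is_lm_add_disjoint:
  assumes f: "is_lm f a" and g: "is_lm g b" and ab: "a \<noteq> b"
  shows "is_lm (f + g) a \<or> is_lm (f + g) b"
proof (cases "lt a b")
  case True
  then have "is_lm (g + f) b"
    using f g by (intro is_lm_add) (auto simp: is_lm_def intro: trans)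
  then show ?thesis by (simp add: add.commute)
next
  case False
  then have "lt b a" using ab total by blast
  then show ?thesis
    using f g by (intro disjI1 is_lm_add) (auto simp: is_lm_def intro: trans)
qed

text \<open>The integers have no zero divisors, so the product of the leading coefficients survives.
  All remaining products of terms lie strictly below \<open>a + b\<close>.\<close>

lemma is_lm_mult:
  assumes f: "is_lm f a" and g: "is_lm g b"
  shows "is_lm (f * g) (a + b)"
proof -
  have split: "\<exists>c h0. h = Poly_Mapping.single m c + h0 \<and> c \<noteq> 0 \<and>
      (\<forall>m'\<in>Poly_Mapping.keys h0. lt m' m)" if "is_lm h m" for h :: mpoly_int and m
  proof (intro exI conjI ballI)
    let ?c = "Poly_Mapping.lookup h m"
    show "h = Poly_Mapping.single m ?c + (h - Poly_Mapping.single m ?c)" by simp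
    show "?c \<noteq> 0" using that by (simp add: is_lm_def in_keys_iff)
    fix m' assume "m' \<in> Poly_Mapping.keys (h - Poly_Mapping.single m ?c)"
    then have "m' \<noteq> m \<and> m' \<in> Poly_Mapping.keys h"
      by (auto simp: in_keys_iff lookup_minus lookup_single when_def split: if_splits)
    then show "lt m' m" using that by (auto simp: is_lm_def)
  qed
  obtain c f0 where f0: "f = Poly_Mapping.single a c + f0" "c \<noteq> 0"
    "\<And>m. m\<in>Poly_Mapping.keys f0 \<Longrightarrow> lt m a"
    using split[OF f] by blast
  obtain d g0 where g0: "g = Poly_Mapping.single b d + g0" "d \<noteq> 0"
    "\<And>m. m\<in>Poly_Mapping.keys g0 \<Longrightarrow> lt m b"
    using split[OF g] by blast
  have add_left: "lt (u + v) (u + w)" if "lt v w" for u v w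
    using add_right[OF that, of u] by (simp add: add.commute)
  \<comment> \<open>Expanding \<open>g\<close> only against the leading term of \<open>f\<close>
    leaves two remainders: one is small because of \<open>g0\<close>, the other because of
    \<open>f0\<close>.\<close>
  have "is_lm (Poly_Mapping.single (a + b) (c * d) +
      (Poly_Mapping.single a c * g0 + f0 * g)) (a + b)"
  proof (rule is_lm_add)
    show "is_lm (Poly_Mapping.single (a + b) (c * d)) (a + b)"
      using f0 g0 by (auto simp: is_lm_def)
    fix m assume "m \<in> Poly_Mapping.keys (Poly_Mapping.single a c * g0 + f0 * g)"
    then consider "m \<in> Poly_Mapping.keys (Poly_Mapping.single a c * g0)"
      | "m \<in> Poly_Mapping.keys (f0 * g)"
      using keys_add[of "Poly_Mapping.single a c * g0" "f0 * g"] by blast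
    then show "lt m (a + b)"
    proof cases
      case 1
      then obtain v where "m = a + v" "v \<in> Poly_Mapping.keys g0"
        using keys_mult[of "Poly_Mapping.single a c" g0] by (auto split: if_splits)
      then show ?thesis using g0 add_left by blast
    next
      case 2
      then obtain u v where uv: "m = u + v" "u \<in> Poly_Mapping.keys f0" "v \<in> Poly_Mapping.keys g"
        using keys_mult[of f0 g] by auto
      then have "lt (u + v) (a + v)" using f0 add_right by blast
      moreover have "v = b \<or> lt (a + v) (a + b)" using uv g add_left by (auto simp: is_lm_def)
      ultimately show ?thesis using uv trans by blast
    qed
  qed
  moreover have "f * g = Poly_Mapping.single (a + b) (c * d) +
      (Poly_Mapping.single a c * g0 + f0 * g)"
    by (simp add: f0(1) g0(1) algebra_simps mult_single)
  ultimately show ?thesis by simp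
qed

end

text \<open>With infinitely many variables \<open>lex_less\<close> has infinite descending chains,
  such as the variables themselves in increasing index. Hence the locale asks for a compatible total
  order but not for well-foundedness.\<close>

interpretation lex: monomial_order lex_less
  by unfold_locales (auto simp: lex_less_eq_less add_strict_right_mono)

interpretation grlex: monomial_order grlex_less
  by unfold_locales
    (auto simp: grlex_less_def lex_less_eq_less total_degree_add add_strict_right_mono)

section \<open>Division with remainder by the first \<open>k\<close> generators\<close>

definition span_upto :: "(nat \<Rightarrow> mpoly_int) \<Rightarrow> nat \<Rightarrow> mpoly_int set" where
  "span_upto g k = {\<Sum>i\<in>{1..k}. q i * g i | q. True}"

lemma zero_in_span_upto: "0 \<in> span_upto g k"
  unfolding span_upto_def by (auto intro!: exI[of _ "\<lambda>_. 0"])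

lemma add_in_span_upto:
  assumes "a \<in> span_upto g k" "b \<in> span_upto g k"
  shows "a + b \<in> span_upto g k"
proof -
  obtain q r where "a = (\<Sum>i\<in>{1..k}. q i * g i)" "b = (\<Sum>i\<in>{1..k}. r i * g i)"
    using assms by (auto simp: span_upto_def)
  then have "a + b = (\<Sum>i\<in>{1..k}. (q i + r i) * g i)" by (simp add: sum.distrib distrib_right)
  then show ?thesis unfolding span_upto_def by (auto intro!: exI[of _ "\<lambda>i. q i + r i"])
qed

lemma mult_in_span_upto:
  assumes "a \<in> span_upto g k"
  shows "c * a \<in> span_upto g k"
proof -
  obtain q where "a = (\<Sum>i\<in>{1..k}. q i * g i)" using assms by (auto simp: span_upto_def)
  then have "c * a = (\<Sum>i\<in>{1..k}. (c * q i) * g i)" by (simp add: sum_distrib_left mult.assoc)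
  then show ?thesis unfolding span_upto_def by (auto intro!: exI[of _ "\<lambda>i. c * q i"])
qed

lemma generator_in_span_upto:
  assumes "i \<in> {1..k}"
  shows "g i \<in> span_upto g k"
proof -
  have "(\<Sum>j\<in>{1..k}. (if j = i then 1 else 0) * g j) = (\<Sum>j\<in>{1..k}. if j = i then g j else 0)"
    by (rule sum.cong) auto
  then have "g i = (\<Sum>j\<in>{1..k}. (if j = i then 1 else 0) * g j)" using assms by simp
  then show ?thesis
    unfolding span_upto_def by (auto intro!: exI[of _ "\<lambda>j. if j = i then 1 else 0"])
qed

lemma span_upto_SucE:
  assumes "f \<in> span_upto g (Suc k)"
  obtains f' q where "f' \<in> span_upto g k" "f = f' + q * g (Suc k)"
  using assms by (auto simp: span_upto_def)

text \<open>These are the standard monomials: those outside the monomial ideal generated by the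
  powers of \<open>x_i\<close> with exponent \<open>b i\<close>, for \<open>i\<close> up to
  \<open>k\<close>.\<close>

definition reduced :: "(nat \<Rightarrow> nat) \<Rightarrow> nat \<Rightarrow> monomial \<Rightarrow> bool" where
  "reduced b k m \<longleftrightarrow> (\<forall>i\<in>{1..k}. Poly_Mapping.lookup m i < b i)"

text \<open>The set is closed under addition, so the existence of remainders only has to be checked
  on single terms.\<close>

definition reducible_polys :: "nat \<Rightarrow> (nat \<Rightarrow> nat) \<Rightarrow> nat \<Rightarrow> mpoly_int set" where
  "reducible_polys n b k = {f. \<exists>r. f - r \<in> span_upto (\<lambda>i. e_tilde (b i) {i..n}) k \<and>
      (\<forall>m\<in>Poly_Mapping.keys r. reduced b k m)}"

lemma reducible_polys_add:
  assumes "f \<in> reducible_polys n b k" "g \<in> reducible_polys n b k"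
  shows "f + g \<in> reducible_polys n b k"
proof -
  let ?I = "span_upto (\<lambda>i. e_tilde (b i) {i..n}) k"
  obtain r s where r: "f - r \<in> ?I" "\<forall>m\<in>Poly_Mapping.keys r. reduced b k m"
    and s: "g - s \<in> ?I" "\<forall>m\<in>Poly_Mapping.keys s. reduced b k m"
    using assms by (auto simp: reducible_polys_def)
  have "f + g - (r + s) \<in> ?I"
    using add_in_span_upto[OF r(1) s(1)] by (simp add: algebra_simps)
  moreover have "\<forall>m\<in>Poly_Mapping.keys (r + s). reduced b k m"
    using r s keys_add[of r s] by blast
  ultimately show ?thesis unfolding reducible_polys_def by blast
qed

lemma span_upto_imp_reducible:
  "f \<in> span_upto (\<lambda>i. e_tilde (b i) {i..n}) k \<Longrightarrow> f \<in> reducible_polys n b k"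
  unfolding reducible_polys_def by (auto intro!: exI[of _ 0])

lemma reducible_polys_sum:
  assumes "\<And>x. x \<in> A \<Longrightarrow> f x \<in> reducible_polys n b k"
  shows "(\<Sum>x\<in>A. f x) \<in> reducible_polys n b k"
  using assms
  by (induction A rule: infinite_finite_induct)
    (auto intro: reducible_polys_add span_upto_imp_reducible zero_in_span_upto)

text \<open>A division step replaces the factor \<open>x_i\<close> to the power \<open>b i\<close>
  by the negated lower terms of the i-th generator. The division uses lex throughout; its result
  mentions no order and therefore serves every monomial order.\<close>

lemma single_in_reducible_polys:
  assumes "k \<le> n"
  shows "Poly_Mapping.single m c \<in> reducible_polys n b k"
proof -
  let ?I = "span_upto (\<lambda>i. e_tilde (b i) {i..n}) k"
  \<comment> \<open>Lex is not well-founded in infinitely many variables; division steps stay in the finite set \<open>M\<close>.\<close>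
  define T where "T = Poly_Mapping.keys m \<union> {1..n}"
  define M where "M = monomials_of_degree (total_degree m) T"
  have finM: "finite M" unfolding M_def T_def by (rule finite_monomials_of_degree) simp
  have "Poly_Mapping.single u c \<in> reducible_polys n b k" if "u \<in> M" for u c
    using that
  proof (induction "card {v \<in> M. v < u}" arbitrary: u c rule: less_induct)
    case less
    show ?case
    proof (cases "reduced b k u")
      case True
      then show ?thesis
        unfolding reducible_polys_def
        by (auto intro!: exI[of _ "Poly_Mapping.single u c"] zero_in_span_upto split: if_splits)
    next
      case False
      then obtain i where i: "i \<in> {1..k}" "b i \<le> Poly_Mapping.lookup u i"
        by (auto simp: reduced_def not_less)
      define x where "x = Poly_Mapping.single i (b i)"
      \<comment> \<open>\<open>w\<close> is the cofactor: multiplying the i-th generator by the term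
        \<open>w\<close> with coefficient \<open>c\<close> produces the given term at
        \<open>u\<close>, and all its other monomials are lex-smaller than \<open>u\<close>.\<close>
      define w where "w = u - x"
      have u: "u = w + x"
        unfolding w_def x_def using i(2)
        by (intro poly_mapping_eqI) (auto simp: lookup_add lookup_minus lookup_single when_def)
      let ?D = "monomials_of_degree (b i) {i..n}"
      have finD: "finite ?D" by (rule finite_monomials_of_degree) simp
      have xD: "x \<in> ?D" unfolding x_def
        by (rule single_in_monomials_of_degree) (use i assms in auto)
      have e: "Poly_Mapping.single w c * e_tilde (b i) {i..n}
          = (\<Sum>t\<in>?D. Poly_Mapping.single (w + t) c)"
        by (simp add: e_tilde_def monomials_of_degree_def sum_distrib_left mult_single)
      also have "\<dots> = Poly_Mapping.single u c + (\<Sum>t\<in>?D - {x}. Poly_Mapping.single (w + t) c)"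
        using finD xD u by (simp add: sum.remove)
      finally have "Poly_Mapping.single u c = Poly_Mapping.single w c * e_tilde (b i) {i..n}
          + (\<Sum>t\<in>?D - {x}. Poly_Mapping.single (w + t) (- c))"
        by (simp add: single_uminus sum_negf)
      moreover have "Poly_Mapping.single w c * e_tilde (b i) {i..n} \<in> reducible_polys n b k"
        by (intro span_upto_imp_reducible mult_in_span_upto
            generator_in_span_upto[of i k "\<lambda>i. e_tilde (b i) {i..n}"] i)
      moreover have "Poly_Mapping.single (w + t) (- c) \<in> reducible_polys n b k"
        if t: "t \<in> ?D - {x}" for t
      proof (rule less.hyps)
        have "t < x" using t monomials_of_degree_less_single by (auto simp: x_def)
        then have lt: "w + t < u" unfolding u by (rule add_strict_left_mono)
        have "Poly_Mapping.keys w \<subseteq> Poly_Mapping.keys u"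
          by (auto simp: w_def in_keys_iff lookup_minus)
        then have "Poly_Mapping.keys (w + t) \<subseteq> T"
          using keys_add[of w t] less.prems t i
          by (fastforce simp: M_def T_def monomials_of_degree_def)
        \<comment> \<open>The generator is homogeneous, so the step preserves the total
          degree.\<close>
        moreover have "total_degree (w + t) = total_degree u"
          using t xD by (simp add: u total_degree_add monomials_of_degree_def)
        ultimately show wM: "w + t \<in> M"
          using less.prems by (simp add: M_def monomials_of_degree_def)
        have "{v \<in> M. v < w + t} \<subset> {v \<in> M. v < u}"
          using lt wM by auto
        then show "card {v \<in> M. v < w + t} < card {v \<in> M. v < u}"
          using finM by (intro psubset_card_mono) auto
      qed
      ultimately show ?thesis by (auto intro!: reducible_polys_add reducible_polys_sum)
    qed
  qed
  then show ?thesis by (auto simp: M_def T_def monomials_of_degree_def)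
qed

lemma reducible_polys_UNIV:
  assumes "k \<le> n"
  shows "f \<in> reducible_polys n b k"
proof -
  have "f = (\<Sum>m\<in>Poly_Mapping.keys f. Poly_Mapping.single m (Poly_Mapping.lookup f m))"
    by (rule poly_mapping_eqI) (auto simp: lookup_sum lookup_single when_def in_keys_iff)
  then show ?thesis
    using single_in_reducible_polys[OF assms] by (metis reducible_polys_sum)
qed

section \<open>Leading monomials in the span of the first \<open>k\<close> generators\<close>

context monomial_order
begin

text \<open>This replaces the check of S-polynomials: the generators' leading monomials are powers
  of distinct variables, which lets the induction add one variable at a time.\<close>

lemma lm_span_upto_not_reduced:
  assumes lm_g: "\<And>i. i \<in> {1..n} \<Longrightarrow> is_lm (e_tilde (b i) {i..n}) (Poly_Mapping.single i (b i))"
    and "k \<le> n" "f \<in> span_upto (\<lambda>i. e_tilde (b i) {i..n}) k" "is_lm f m"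
  shows "\<not> reduced b k m"
  using assms(2-)
proof (induction k arbitrary: f m)
  \<comment> \<open>The empty span contains only 0, which has no leading monomial.\<close>
  case 0
  then show ?case by (auto simp: span_upto_def is_lm_def)
next
  case (Suc k)
  let ?g = "\<lambda>i. e_tilde (b i) {i..n}"
  let ?x = "Poly_Mapping.single (Suc k) (b (Suc k))"
  obtain f1 q1 where f1: "f1 \<in> span_upto ?g k" "f = f1 + q1 * ?g (Suc k)"
    using span_upto_SucE[OF Suc.prems(2)] by blast
  obtain q where q: "q1 - q \<in> span_upto ?g k" "\<forall>m\<in>Poly_Mapping.keys q. reduced b k m"
    using reducible_polys_UNIV[of k n q1 b] Suc.prems(1) by (auto simp: reducible_polys_def)
  \<comment> \<open>Since \<open>q1 - q\<close> lies in the previous span, so does its multiple by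
    the new generator. It is moved into \<open>f'\<close>, leaving the reduced \<open>q\<close> as
    coefficient.\<close>
  define f' where "f' = f1 + ?g (Suc k) * (q1 - q)"
  have f': "f' \<in> span_upto ?g k"
    unfolding f'_def by (intro add_in_span_upto mult_in_span_upto f1 q)
  have f: "f = f' + q * ?g (Suc k)" by (simp add: f'_def f1 algebra_simps)
  have IH: "\<not> reduced b k u" if "is_lm f' u" for u
    using Suc.IH[OF _ f' that] Suc.prems(1) by simp
  have mono: "reduced b k u" if "reduced b (Suc k) u" for u
    using that by (auto simp: reduced_def)
  show ?case
  proof (cases "q = 0")
    case True
    then show ?thesis using IH[of m] Suc.prems(3) mono f by auto
  next
    case False
    then obtain v where v: "is_lm q v" using ex_is_lm by blast
    have p: "is_lm (q * ?g (Suc k)) (v + ?x)"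
      using is_lm_mult[OF v lm_g] Suc.prems(1) by simp
    have nr: "\<not> reduced b (Suc k) (v + ?x)"
      by (auto simp: reduced_def lookup_add intro!: bexI[of _ "Suc k"])
    \<comment> \<open>Adding \<open>?x\<close> changes only the exponent of variable
      \<open>Suc k\<close>, so all conditions for indices up to \<open>k\<close> persist. This
      separates \<open>v + ?x\<close> from the leading monomial of \<open>f'\<close>.\<close>
    have "reduced b k v" using v q by (auto simp: is_lm_def)
    then have r: "reduced b k (v + ?x)"
      by (auto simp: reduced_def lookup_add lookup_single when_def)
    show ?thesis
    proof (cases "f' = 0")
      case True
      then show ?thesis using p nr f Suc.prems(3) is_lm_unique by auto
    next
      case False
      then obtain u where u: "is_lm f' u" using ex_is_lm by blast
      then have "u \<noteq> v + ?x" using r IH by blast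
      from is_lm_add_disjoint[OF u p this] have "m = u \<or> m = v + ?x"
        using Suc.prems(3) is_lm_unique f by blast
      then show ?thesis using nr IH[OF u] mono by blast
    qed
  qed
qed

end

section \<open>The polynomial ring in \<open>n\<close> variables and its ideals\<close>

lemma add_in_int_mpoly_ring:
  assumes "f \<in> carrier (int_mpoly_ring n)" "g \<in> carrier (int_mpoly_ring n)"
  shows "f + g \<in> carrier (int_mpoly_ring n)"
  using assms keys_add[of f g] by (simp add: int_mpoly_ring_def) blast

lemma mult_in_int_mpoly_ring:
  assumes "f \<in> carrier (int_mpoly_ring n)" "g \<in> carrier (int_mpoly_ring n)"
  shows "f * g \<in> carrier (int_mpoly_ring n)"
proof -
  have "Poly_Mapping.keys m \<subseteq> {1..n}" if "m \<in> Poly_Mapping.keys (f * g)" for m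
  proof -
    obtain u v where uv: "m = u + v" "u \<in> Poly_Mapping.keys f" "v \<in> Poly_Mapping.keys g"
      using keys_mult[of f g] \<open>m \<in> _\<close> by blast
    then have "Poly_Mapping.keys u \<subseteq> {1..n}" "Poly_Mapping.keys v \<subseteq> {1..n}"
      using assms by (auto simp: int_mpoly_ring_def)
    then show ?thesis using uv(1) keys_add[of u v] by blast
  qed
  then show ?thesis by (simp add: int_mpoly_ring_def)
qed

lemma uminus_in_int_mpoly_ring:
  "f \<in> carrier (int_mpoly_ring n) \<Longrightarrow> - f \<in> carrier (int_mpoly_ring n)"
  by (simp add: int_mpoly_ring_def)

lemma single_in_int_mpoly_ring:
  "Poly_Mapping.keys m \<subseteq> {1..n} \<Longrightarrow> Poly_Mapping.single m c \<in> carrier (int_mpoly_ring n)"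
  by (simp add: int_mpoly_ring_def)

lemma int_mpoly_ring_simps:
  "mult (int_mpoly_ring n) = (*)" "one (int_mpoly_ring n) = 1"
  "zero (int_mpoly_ring n) = 0" "add (int_mpoly_ring n) = (+)"
  by (simp_all add: int_mpoly_ring_def)

lemma zero_one_in_int_mpoly_ring:
  "0 \<in> carrier (int_mpoly_ring n)" "1 \<in> carrier (int_mpoly_ring n)"
  by (simp_all add: int_mpoly_ring_def)

lemma cring_int_mpoly_ring: "cring (int_mpoly_ring n)"
proof (rule cringI)
  show "abelian_group (int_mpoly_ring n)"
  proof (rule abelian_groupI)
    fix f assume "f \<in> carrier (int_mpoly_ring n)"
    then show "\<exists>g\<in>carrier (int_mpoly_ring n).
        g \<oplus>\<^bsub>int_mpoly_ring n\<^esub> f = \<zero>\<^bsub>int_mpoly_ring n\<^esub>"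
      by (intro bexI[of _ "- f"]) (auto simp: int_mpoly_ring_simps uminus_in_int_mpoly_ring)
  qed (auto simp: int_mpoly_ring_simps add_in_int_mpoly_ring zero_one_in_int_mpoly_ring
      algebra_simps)
  show "Group.comm_monoid (int_mpoly_ring n)"
    by (rule comm_monoidI)
      (auto simp: int_mpoly_ring_simps mult_in_int_mpoly_ring zero_one_in_int_mpoly_ring
        algebra_simps)
qed (simp add: int_mpoly_ring_simps algebra_simps)

lemma a_inv_int_mpoly_ring:
  assumes "f \<in> carrier (int_mpoly_ring n)"
  shows "\<ominus>\<^bsub>int_mpoly_ring n\<^esub> f = - f"
proof -
  interpret cring "int_mpoly_ring n" by (rule cring_int_mpoly_ring)
  show ?thesis
    by (rule minus_equality) (use assms in \<open>auto simp: int_mpoly_ring_simps uminus_in_int_mpoly_ring\<close>)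
qed

text \<open>The coefficients in \<open>span_upto\<close> may involve any variable, so the span is
  cut down to the carrier. An ideal containing the generators is all that is required to bound the
  generated ideal from above.\<close>

lemma ideal_span_upto:
  "ideal (carrier (int_mpoly_ring n) \<inter> span_upto g k) (int_mpoly_ring n)"
proof -
  interpret cring "int_mpoly_ring n" by (rule cring_int_mpoly_ring)
  have uminus: "- f \<in> span_upto g k" if "f \<in> span_upto g k" for f
    using mult_in_span_upto[OF that, of "- 1"] by simp
  show ?thesis
  proof (rule idealI)
    show "subgroup (carrier (int_mpoly_ring n) \<inter> span_upto g k)
        (add_monoid (int_mpoly_ring n))"
    proof (rule add.subgroupI)
      fix f assume "f \<in> carrier (int_mpoly_ring n) \<inter> span_upto g k"
      then show "\<ominus>\<^bsub>int_mpoly_ring n\<^esub> f \<in> carrier (int_mpoly_ring n) \<inter> span_upto g k"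
        using uminus by (simp add: a_inv_int_mpoly_ring uminus_in_int_mpoly_ring)
    qed (use zero_one_in_int_mpoly_ring zero_in_span_upto in
        \<open>auto simp: int_mpoly_ring_simps add_in_int_mpoly_ring add_in_span_upto\<close>)
  next
    fix a x
    assume "a \<in> carrier (int_mpoly_ring n) \<inter> span_upto g k" "x \<in> carrier (int_mpoly_ring n)"
    then have "x * a \<in> carrier (int_mpoly_ring n) \<inter> span_upto g k"
      by (auto simp: mult_in_int_mpoly_ring mult_in_span_upto)
    then show "x \<otimes>\<^bsub>int_mpoly_ring n\<^esub> a \<in> carrier (int_mpoly_ring n) \<inter> span_upto g k"
      and "a \<otimes>\<^bsub>int_mpoly_ring n\<^esub> x \<in> carrier (int_mpoly_ring n) \<inter> span_upto g k"
      by (auto simp: int_mpoly_ring_simps mult.commute)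
  qed (rule ring_axioms)
qed

lemma e_tilde_in_int_mpoly_ring:
  assumes "S \<subseteq> {1..n}"
  shows "e_tilde d S \<in> carrier (int_mpoly_ring n)"
proof -
  have "finite S" using assms by (rule finite_subset) simp
  then show ?thesis
    using assms by (auto simp: int_mpoly_ring_def keys_e_tilde monomials_of_degree_def)
qed

section \<open>From divisibility of leading monomials to the Groebner basis property\<close>

context monomial_order
begin

lemma leading_term_eq_single:
  assumes "is_lm f m"
  shows "leading_term lt f = Poly_Mapping.single m (Poly_Mapping.lookup f m)"
proof -
  have "f \<noteq> 0" using assms by (auto simp: is_lm_def)
  then show ?thesis using is_lm_imp_leading_monomial[OF assms] by (simp add: leading_term_def)
qed

text \<open>Over the integers divisibility of monomials alone is not enough. Here every generator
  has leading coefficient 1, so a leading term with any coefficient is a multiple of some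
  generator's leading term.\<close>

lemma groebner_basis_e_tilde:
  assumes lm_g: "\<And>i. i \<in> {1..n} \<Longrightarrow> is_lm (e_tilde (b i) {i..n}) (Poly_Mapping.single i (b i))"
  defines "G \<equiv> (\<lambda>i. e_tilde (b i) {i..n}) ` {1..n}"
  shows "groebner_basis n lt G (genideal (int_mpoly_ring n) G)"
proof -
  let ?R = "int_mpoly_ring n" and ?g = "\<lambda>i. e_tilde (b i) {i..n}"
  interpret cring ?R by (rule cring_int_mpoly_ring)
  have G: "G \<subseteq> carrier ?R"
    unfolding G_def by (auto intro!: e_tilde_in_int_mpoly_ring)
  have "G \<subseteq> span_upto ?g n"
    unfolding G_def using generator_in_span_upto[of _ n ?g] by blast
  then have I_sub: "genideal ?R G \<subseteq> carrier ?R \<inter> span_upto ?g n"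
    using G ideal_span_upto by (intro genideal_minimal) auto
  have G_sub: "G \<subseteq> genideal ?R G" by (rule genideal_self[OF G])
  have lt_g: "leading_term lt (?g i) = Poly_Mapping.single (Poly_Mapping.single i (b i)) 1"
    if "i \<in> {1..n}" for i
    using leading_term_eq_single[OF lm_g[OF that]] that
    by (simp add: lookup_e_tilde single_in_monomials_of_degree)
  \<comment> \<open>The facts on \<open>genideal\<close> used below require the generating sets to
    lie in the carrier.\<close>
  have lt_carrier: "leading_term lt f \<in> carrier ?R" if "f \<in> carrier ?R" for f
  proof (cases "f = 0")
    case True
    then show ?thesis by (simp add: leading_term_def zero_one_in_int_mpoly_ring)
  next
    case False
    then obtain m where m: "is_lm f m" using ex_is_lm by blast
    then have "Poly_Mapping.keys m \<subseteq> {1..n}"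
      using that by (auto simp: is_lm_def int_mpoly_ring_def)
    then show ?thesis using leading_term_eq_single[OF m] by (simp add: single_in_int_mpoly_ring)
  qed
  have ltG: "leading_term lt ` G \<subseteq> carrier ?R" using G lt_carrier by blast
  have ltI: "leading_term lt ` genideal ?R G \<subseteq> carrier ?R" using I_sub lt_carrier by blast
  have L: "ideal (genideal ?R (leading_term lt ` G)) ?R" by (rule genideal_ideal[OF ltG])
  have "leading_term lt f \<in> genideal ?R (leading_term lt ` G)" if f: "f \<in> genideal ?R G" for f
  proof (cases "f = 0")
    case True
    then show ?thesis
      using additive_subgroup.zero_closed[OF ideal.axioms(1)[OF L]]
      by (simp add: leading_term_def int_mpoly_ring_simps)
  next
    case False
    then obtain m where m: "is_lm f m" using ex_is_lm by blast
    have "\<not> reduced b n m"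
      by (rule lm_span_upto_not_reduced[OF lm_g _ _ m]) (use f I_sub in auto)
    then obtain i where i: "i \<in> {1..n}" "b i \<le> Poly_Mapping.lookup m i"
      by (auto simp: reduced_def not_less)
    define x where "x = Poly_Mapping.single i (b i)"
    let ?c = "Poly_Mapping.lookup f m"
    have mx: "m = (m - x) + x"
      unfolding x_def using i(2)
      by (intro poly_mapping_eqI) (auto simp: lookup_add lookup_minus lookup_single when_def)
    have "Poly_Mapping.keys m \<subseteq> {1..n}"
      using m f I_sub by (auto simp: is_lm_def int_mpoly_ring_def)
    moreover have "Poly_Mapping.keys (m - x) \<subseteq> Poly_Mapping.keys m"
      by (auto simp: in_keys_iff lookup_minus)
    ultimately have "Poly_Mapping.keys (m - x) \<subseteq> {1..n}" by blast
    then have "Poly_Mapping.single (m - x) ?c \<in> carrier ?R"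
      by (rule single_in_int_mpoly_ring)
    moreover have "Poly_Mapping.single x 1 \<in> genideal ?R (leading_term lt ` G)"
      using genideal_self[OF ltG] lt_g[OF i(1)] i(1) unfolding G_def x_def by force
    \<comment> \<open>The cofactor carries the whole integer coefficient \<open>?c\<close>; this is
      where the leading coefficient 1 enters.\<close>
    ultimately have "Poly_Mapping.single (m - x) ?c * Poly_Mapping.single x 1
        \<in> genideal ?R (leading_term lt ` G)"
      using ideal.I_l_closed[OF L] by (simp add: int_mpoly_ring_simps)
    then show ?thesis
      using mx leading_term_eq_single[OF m] by (simp add: mult_single)
  qed
  then have "genideal ?R (leading_term lt ` genideal ?R G) \<subseteq> genideal ?R (leading_term lt ` G)"
    by (intro genideal_minimal[OF L]) blast
  moreover have "leading_term lt ` G \<subseteq> genideal ?R (leading_term lt ` genideal ?R G)"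
    using genideal_self[OF ltI] G_sub by blast
  then have "genideal ?R (leading_term lt ` G) \<subseteq> genideal ?R (leading_term lt ` genideal ?R G)"
    by (intro genideal_minimal genideal_ideal[OF ltI])
  ultimately show ?thesis
    unfolding groebner_basis_def using genideal_ideal[OF G] G_sub by (simp add: G_def)
qed

end

section \<open>The generators under lex and graded lex\<close>

theorem theorem5p7:
  fixes n :: nat and h :: "nat \<Rightarrow> nat"
  assumes "hessenberg n h"
  shows "groebner_basis n lex_less (J_generators n h) (J_ideal n h)
       \<and> groebner_basis n grlex_less (J_generators n h) (J_ideal n h)"
proof -
  let ?b = "degree_tuple n h"
  have G: "J_generators n h = (\<lambda>i. e_tilde (?b i) {i..n}) ` {1..n}"
    by (auto simp: J_generators_def)
  have "lex.is_lm (e_tilde (?b i) {i..n}) (Poly_Mapping.single i (?b i))"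
    and "grlex.is_lm (e_tilde (?b i) {i..n}) (Poly_Mapping.single i (?b i))"
    if "i \<in> {1..n}" for i
  proof -
    have *: "Poly_Mapping.single i (?b i) \<in> monomials_of_degree (?b i) {i..n}"
      by (rule single_in_monomials_of_degree) (use that in auto)
    show "lex.is_lm (e_tilde (?b i) {i..n}) (Poly_Mapping.single i (?b i))"
      using * monomials_of_degree_less_single
      unfolding lex.is_lm_def by (auto simp: keys_e_tilde lex_less_eq_less)
    \<comment> \<open>All monomials of the generator have the same degree, so graded lex falls back
      to lex.\<close>
    have "grlex_less m (Poly_Mapping.single i (?b i))"
      if m: "m \<in> monomials_of_degree (?b i) {i..n}" "m \<noteq> Poly_Mapping.single i (?b i)" for m
      using monomials_of_degree_less_single[OF m] m(1)
      by (simp add: grlex_less_def lex_less_eq_less total_degree_single monomials_of_degree_def)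
    then show "grlex.is_lm (e_tilde (?b i) {i..n}) (Poly_Mapping.single i (?b i))"
      using * unfolding grlex.is_lm_def by (auto simp: keys_e_tilde)
  qed
  then show ?thesis
    unfolding J_ideal_def G
    by (intro conjI lex.groebner_basis_e_tilde grlex.groebner_basis_e_tilde)
qed

end
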